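(* Suppose that $\|p_1\|_\infty=\sup_{x,y\in\mathbb R^d}p_1(x,y)<\infty$ and that $\mathbf X$ is $\mu$-a.s. $V$-ergodic at speed $\Xi$, with $\mu$-full set $\Lambda$ and constant $C$, such that $V\mathbf 1_\Lambda$ is locally bounded and $\int_0^\infty\Xi(t)\,dt<\infty$. For compact $\mathcal S\subset\mathbb R^d$ set $$r_{\mathcal S}(t)=2C\,\|p_1\|_\infty\,\sup_{x\in\mathcal S\cap\Lambda}V(x)\;\Xi(t-1),\qquad t>1.$$ Then the local uniform transition density convergence condition holds with these functions $r_{\mathcal S}$; that is, there is a $\mu$-full set $\Lambda$ such that for any compact set $\mathcal S\subset\mathbb R^d$, $$\sup_{x\in\mathcal S\cap\Lambda,\;y\in\mathcal S}|p_t(x,y)-\rho(y)|\le r_{\mathcal S}(t)\quad\text{for all }t>1,\qquad\text{and}\qquad \int_1^\infty r_{\mathcal S}(t)\,dt<\infty .$$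
   Context: $\mathbf X=(X_t)_{t\ge 0}$ with laws $(\mathbb P^x)_{x\in\mathbb R^d}$ is a non-explosive Borel right Markov process with state space $(\mathbb R^d,\mathcal B(\mathbb R^d))$ and semigroup $P_t(x,B)=\mathbb P^x(X_t\in B)$. Standing assumption: for any $t>0$, $x\in\mathbb R^d$ there is a measurable transition density $p_t:\mathbb R^d\times\mathbb R^d\to\mathbb R_+$ with $P_t(x,B)=\int_B p_t(x,y)\,dy$ for all Borel $B$, and $\mathbf X$ admits a unique invariant probability measure $\mu$, which is absolutely continuous with density $\rho:\mathbb R^d\to\mathbb R_+$. A Borel set $B$ is $\mu$-full if $\mu(B)=1$. $\mathbf X$ is $\mu$-a.s. $V$-ergodic at speed $\Xi$ if, for some $\mu$-full set $\Lambda$ and some constant $C$, $\|P_t(x,\cdot)-\mu\|_{\mathrm{TV}}\le C\,V(x)\,\Xi(t)$ for all $t\ge0$, $x\in\Lambda$, where $V:\mathbb R^d\to[0,\infty]$ with $V\mathbf 1_\Lambda(x)<\infty$, and $\|\nu\|_{\mathrm{TV}}=\sup_{|f|\le1}|\nu(f)|$ for a signed measure $\nu$.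
   Formalization: As densities are fixed only up to null sets in y, the bound at every y is proved for p, ρ satisfying p_t(x,y)=∫p_{t-1}(x,z)p_1(z,y)dz (t>1) and ρ(y)=∫ρ(z)p_1(z,y)dz at every point, and otherwise for a.e.-equal versions with the same p_1, which are shown to exist. *)

theory Defs
  imports "HOL-Probability.Probability"
begin

section \<open>Borel right processes on Euclidean space\<close>

definition natural_filtration ::
  "'w measure \<Rightarrow> (real \<Rightarrow> 'w \<Rightarrow> 'a::euclidean_space) \<Rightarrow> real \<Rightarrow> 'w measure" where
  "natural_filtration M X t =
     sigma (space M) (\<Union>s\<in>{0..t}. {X s -` B \<inter> space M | B. B \<in> sets borel})"

definition transition_semigroup ::
  "('a \<Rightarrow> 'w measure) \<Rightarrow> (real \<Rightarrow> 'w \<Rightarrow> 'a) \<Rightarrow> real \<Rightarrow> 'a::euclidean_space \<Rightarrow> 'a measure" where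
  "transition_semigroup P X t x = distr (P x) borel (X t)"

definition excessive ::
  "(real \<Rightarrow> 'a::euclidean_space \<Rightarrow> 'a measure) \<Rightarrow> real \<Rightarrow> ('a \<Rightarrow> ennreal) \<Rightarrow> bool" where
  "excessive K \<alpha> f \<longleftrightarrow>
     f \<in> borel_measurable borel \<and>
     (\<forall>t\<ge>0. \<forall>x. ennreal (exp (- \<alpha> * t)) * (\<integral>\<^sup>+y. f y \<partial>K t x) \<le> f x) \<and>
     (\<forall>x. ((\<lambda>t. ennreal (exp (- \<alpha> * t)) * (\<integral>\<^sup>+y. f y \<partial>K t x)) \<longlongrightarrow> f x) (at_right 0))"

text \<open>
  Right processes in the sense of Sharpe and Getoor: right-continuous normal Markov processes
  for which \<open>\<alpha>\<close>-excessive functions are almost surely right-continuous along the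
  paths (hypotheses HD1 and HD2; HD2 carries the strong Markov property). For a Borel semigroup
  it is enough to ask HD2 of Borel excessive functions, since these include the potentials of
  bounded Borel functions. Time is \<open>[0, \<infinity>)\<close>; nothing is required at
  negative times. The process is non-explosive because it takes values in the state space at
  every time, without a cemetery point.
\<close>

locale borel_right_process =
  fixes M :: "'w measure"
    and P :: "'a::euclidean_space \<Rightarrow> 'w measure"
    and X :: "real \<Rightarrow> 'w \<Rightarrow> 'a"
  assumes prob_P: "\<And>x. prob_space (P x)"
    and sets_P: "\<And>x. sets (P x) = sets M"
    and measurable_X: "\<And>t. 0 \<le> t \<Longrightarrow> X t \<in> borel_measurable M"
    and normal: "\<And>x. AE \<omega> in P x. X 0 \<omega> = x"
    and borel_semigroup:
      "\<And>t B. 0 \<le> t \<Longrightarrow> B \<in> sets borel \<Longrightarrow>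
         (\<lambda>x. measure (transition_semigroup P X t x) B) \<in> borel_measurable borel"
    and markov:
      "\<And>x s t B. 0 \<le> s \<Longrightarrow> 0 \<le> t \<Longrightarrow> B \<in> sets borel \<Longrightarrow>
         AE \<omega> in P x.
           real_cond_exp (P x) (natural_filtration M X t) (\<lambda>\<omega>'. indicator B (X (t + s) \<omega>')) \<omega> =
           measure (transition_semigroup P X s (X t \<omega>)) B"
    and right_continuous:
      "\<And>\<omega> t. \<omega> \<in> space M \<Longrightarrow> 0 \<le> t \<Longrightarrow> continuous (at_right t) (\<lambda>s. X s \<omega>)"
    and excessive_right_continuous:
      "\<And>x \<alpha> f. 0 < \<alpha> \<Longrightarrow> excessive (transition_semigroup P X) \<alpha> f \<Longrightarrow>
         AE \<omega> in P x. \<forall>t\<ge>0. continuous (at_right t) (\<lambda>s. f (X s \<omega>))"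


section \<open>Invariant measures and densities\<close>

definition invariant_prob ::
  "(real \<Rightarrow> 'a::euclidean_space \<Rightarrow> 'a measure) \<Rightarrow> 'a measure \<Rightarrow> bool" where
  "invariant_prob K \<nu> \<longleftrightarrow>
     prob_space \<nu> \<and> sets \<nu> = sets borel \<and>
     (\<forall>t\<ge>0. \<forall>B\<in>sets borel. (\<integral>\<^sup>+x. emeasure (K t x) B \<partial>\<nu>) = emeasure \<nu> B)"

definition unique_invariant_prob ::
  "(real \<Rightarrow> 'a::euclidean_space \<Rightarrow> 'a measure) \<Rightarrow> 'a measure \<Rightarrow> bool" where
  "unique_invariant_prob K \<mu> \<longleftrightarrow>
     invariant_prob K \<mu> \<and> (\<forall>\<nu>. invariant_prob K \<nu> \<longrightarrow> \<nu> = \<mu>)"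

definition lebesgue_density :: "'a::euclidean_space measure \<Rightarrow> ('a \<Rightarrow> real) \<Rightarrow> bool" where
  "lebesgue_density \<mu> \<rho> \<longleftrightarrow>
     \<rho> \<in> borel_measurable borel \<and> (\<forall>y. 0 \<le> \<rho> y) \<and> \<mu> = density lborel (\<lambda>y. ennreal (\<rho> y))"

definition transition_density ::
  "(real \<Rightarrow> 'a::euclidean_space \<Rightarrow> 'a measure) \<Rightarrow> (real \<Rightarrow> 'a \<Rightarrow> 'a \<Rightarrow> real) \<Rightarrow> bool" where
  "transition_density K p \<longleftrightarrow>
     (\<forall>t>0. (\<lambda>(x, y). p t x y) \<in> borel_measurable (borel \<Otimes>\<^sub>M borel) \<and>
            (\<forall>x y. 0 \<le> p t x y) \<and>
            (\<forall>x. \<forall>B\<in>sets borel. emeasure (K t x) B = (\<integral>\<^sup>+y\<in>B. ennreal (p t x y) \<partial>lborel)))"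

text \<open>
  The two preceding notions determine the densities only up to Lebesgue null sets in \<open>y\<close>,
  whereas a supremum over all \<open>y\<close> depends on the version. The version is pinned down, for
  \<open>t > 1\<close>, by asking for the Chapman--Kolmogorov and the invariance equation with a last
  time step of length 1 at every point.
\<close>

definition consistent_densities ::
  "(real \<Rightarrow> 'a::euclidean_space \<Rightarrow> 'a \<Rightarrow> real) \<Rightarrow> ('a \<Rightarrow> real) \<Rightarrow> bool" where
  "consistent_densities p \<rho> \<longleftrightarrow>
     (\<forall>t>1. \<forall>x y. ennreal (p t x y) =
        (\<integral>\<^sup>+z. ennreal (p (t - 1) x z) * ennreal (p 1 z y) \<partial>lborel)) \<and>
     (\<forall>y. ennreal (\<rho> y) = (\<integral>\<^sup>+z. ennreal (\<rho> z) * ennreal (p 1 z y) \<partial>lborel))"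

definition versions ::
  "(real \<Rightarrow> 'a::euclidean_space \<Rightarrow> 'a \<Rightarrow> real) \<Rightarrow> ('a \<Rightarrow> real) \<Rightarrow>
   (real \<Rightarrow> 'a \<Rightarrow> 'a \<Rightarrow> real) \<Rightarrow> ('a \<Rightarrow> real) \<Rightarrow> bool" where
  "versions p \<rho> q \<sigma> \<longleftrightarrow>
     (\<forall>t>0. \<forall>x. AE y in lborel. q t x y = p t x y) \<and> (AE y in lborel. \<sigma> y = \<rho> y)"


section \<open>Ergodicity and convergence of densities\<close>

definition full_set :: "'a::euclidean_space measure \<Rightarrow> 'a set \<Rightarrow> bool" where
  "full_set \<mu> \<Lambda> \<longleftrightarrow> \<Lambda> \<in> sets borel \<and> emeasure \<mu> \<Lambda> = 1"

text \<open>
  The total variation norm of the signed measure \<open>\<nu> - \<mu>\<close>, as the supremum of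
  \<open>\<bar>\<nu>(f) - \<mu>(f)\<bar>\<close> over \<open>\<bar>f\<bar> \<le> 1\<close>;
  with this normalisation two probability measures are at distance at most 2.
\<close>

definition tv_dist ::
  "'a::euclidean_space measure \<Rightarrow> 'a measure \<Rightarrow> ennreal" where
  "tv_dist \<nu> \<mu> =
     (SUP f \<in> {f \<in> borel_measurable borel. \<forall>x. \<bar>f x\<bar> \<le> (1::real)}.
        ennreal \<bar>(\<integral>x. f x \<partial>\<nu>) - (\<integral>x. f x \<partial>\<mu>)\<bar>)"

definition ergodic_at_speed ::
  "(real \<Rightarrow> 'a::euclidean_space \<Rightarrow> 'a measure) \<Rightarrow> 'a measure \<Rightarrow> ('a \<Rightarrow> ennreal) \<Rightarrow>
   (real \<Rightarrow> real) \<Rightarrow> 'a set \<Rightarrow> real \<Rightarrow> bool" where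
  "ergodic_at_speed K \<mu> V \<Xi> \<Lambda> C \<longleftrightarrow>
     full_set \<mu> \<Lambda> \<and> 0 \<le> C \<and> (\<forall>t\<ge>0. 0 \<le> \<Xi> t) \<and> (\<forall>x\<in>\<Lambda>. V x < \<infinity>) \<and>
     (\<forall>t\<ge>0. \<forall>x\<in>\<Lambda>. tv_dist (K t x) \<mu> \<le> ennreal C * V x * ennreal (\<Xi> t))"

definition locally_bounded :: "('a::euclidean_space \<Rightarrow> ennreal) \<Rightarrow> bool" where
  "locally_bounded f \<longleftrightarrow> (\<forall>x. \<exists>U. open U \<and> x \<in> U \<and> (SUP y\<in>U. f y) < \<infinity>)"

definition sup_norm :: "('a \<Rightarrow> 'a \<Rightarrow> real) \<Rightarrow> ennreal" where
  "sup_norm f = (SUP x. SUP y. ennreal \<bar>f x y\<bar>)"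

definition rate ::
  "(real \<Rightarrow> 'a::euclidean_space \<Rightarrow> 'a \<Rightarrow> real) \<Rightarrow> ('a \<Rightarrow> ennreal) \<Rightarrow> (real \<Rightarrow> real) \<Rightarrow>
   'a set \<Rightarrow> real \<Rightarrow> 'a set \<Rightarrow> real \<Rightarrow> ennreal" where
  "rate p V \<Xi> \<Lambda> C S t =
     2 * ennreal C * sup_norm (p 1) * (SUP x\<in>S \<inter> \<Lambda>. V x) * ennreal (\<Xi> (t - 1))"

text \<open>
  The full set is a parameter here, so that it can be the one that enters the rate; the suprema
  are taken in \<open>[0, \<infinity>]\<close>, where the supremum of the empty set is 0.
\<close>

definition local_uniform_density_convergence ::
  "'a::euclidean_space measure \<Rightarrow> (real \<Rightarrow> 'a \<Rightarrow> 'a \<Rightarrow> real) \<Rightarrow> ('a \<Rightarrow> real) \<Rightarrow>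
   'a set \<Rightarrow> ('a set \<Rightarrow> real \<Rightarrow> ennreal) \<Rightarrow> bool" where
  "local_uniform_density_convergence \<mu> p \<rho> \<Lambda> r \<longleftrightarrow>
     full_set \<mu> \<Lambda> \<and>
     (\<forall>S. compact S \<longrightarrow>
        (\<forall>t>1. r S t < \<infinity>) \<and>
        (\<forall>t>1. (SUP x\<in>S \<inter> \<Lambda>. SUP y\<in>S. ennreal \<bar>p t x y - \<rho> y\<bar>) \<le> r S t) \<and>
        r S \<in> borel_measurable (restrict_space borel {1<..}) \<and>
        (\<integral>\<^sup>+t\<in>{1<..}. r S t \<partial>lborel) < \<infinity>)"

end

theory Submission
  imports Defs
begin

text \<open>
  Running the process for a last unit of time smooths. For \<open>t > 1\<close> the
  Chapman--Kolmogorov equation writes \<open>p t x y\<close> as the integral of the single bounded function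
  \<open>p 1 \<cdot> y\<close> against the law of the process at time \<open>t - 1\<close>, and invariance writes
  \<open>\<rho> y\<close> as the integral of the same function against \<open>\<mu>\<close>. Hence, at every
  point \<open>y\<close>, the difference of the two densities is at most the supremum norm of
  \<open>p 1\<close> times the total variation distance at time \<open>t - 1\<close>
  (\<open>unit_step_diff_le_tv_dist\<close>), and ergodicity bounds the latter by
  \<open>C V(x) \<Xi>(t - 1)\<close>. Taking the supremum over \<open>x\<close> in a compact set costs only a
  finite constant, since a locally bounded function is bounded on compact sets, and the integral of
  the rate over \<open>t > 1\<close> is a multiple of the integral of \<open>\<Xi>\<close>.

  This argument needs the two integral equations at every point, which is what consistency of the
  densities means. Arbitrary densities satisfy the equations only almost everywhere
  (\<open>unit_step_is_density\<close>). Replacing them, for \<open>t > 1\<close>, by the right-hand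
  sides of the equations changes them only on null sets. The equations integrate over the
  intermediate point, so their right-hand sides do not notice this change, and the new versions are
  consistent (\<open>consistent_versions_exist\<close>).
\<close>

section \<open>Compactness, total variation and densities\<close>

lemma SUP_compact_finite:
  assumes "locally_bounded f" and "compact S"
  shows "(SUP x\<in>S. f x) < \<infinity>"
proof -
  have "\<forall>x. \<exists>W. open W \<and> x \<in> W \<and> (SUP y\<in>W. f y) < \<infinity>"
    using assms(1) unfolding locally_bounded_def .
  from choice[OF this] obtain U where
    "\<forall>x. open (U x) \<and> x \<in> U x \<and> (SUP y\<in>U x. f y) < \<infinity>" ..
  then have U: "open (U x)" "x \<in> U x" "(SUP y\<in>U x. f y) < \<infinity>" for x by auto
  have "S \<subseteq> (\<Union>x\<in>S. U x)" using U(2) by auto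
  with U(1) obtain D where D: "D \<subseteq> S" "finite D" "S \<subseteq> (\<Union>x\<in>D. U x)"
    by (rule compactE_image[OF assms(2)])
  have "f x \<le> (\<Sum>d\<in>D. SUP y\<in>U d. f y)" if x: "x \<in> S" for x
  proof -
    obtain d where d: "d \<in> D" "x \<in> U d" using D x by blast
    have "f x \<le> (SUP y\<in>U d. f y)" using d by (intro SUP_upper)
    also have "\<dots> \<le> (\<Sum>d\<in>D. SUP y\<in>U d. f y)" using d D by (intro member_le_sum) auto
    finally show ?thesis .
  qed
  then have "(SUP x\<in>S. f x) \<le> (\<Sum>d\<in>D. SUP y\<in>U d. f y)" by (rule SUP_least)
  also have "\<dots> < \<infinity>" using U D by (auto simp: less_top[symmetric])
  finally show ?thesis .
qed

text \<open>
  Dividing by the bound \<open>c\<close> turns \<open>f\<close> into one of the functions over which the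
  total variation distance takes its supremum; if \<open>c = 0\<close>, both integrals vanish.
\<close>

lemma tv_dist_bounds_integrals:
  fixes f :: "'a::euclidean_space \<Rightarrow> real"
  assumes [measurable]: "f \<in> borel_measurable borel" and bound: "\<And>x. \<bar>f x\<bar> \<le> c"
  shows "ennreal \<bar>(\<integral>x. f x \<partial>\<nu>) - (\<integral>x. f x \<partial>\<mu>)\<bar> \<le> ennreal c * tv_dist \<nu> \<mu>"
proof (cases "c = 0")
  case True
  then show ?thesis using bound by simp
next
  case False
  then have c: "0 < c" using bound[of undefined] by linarith
  have "ennreal \<bar>(\<integral>x. f x \<partial>\<nu>) - (\<integral>x. f x \<partial>\<mu>)\<bar>
      = ennreal c * ennreal \<bar>(\<integral>x. f x / c \<partial>\<nu>) - (\<integral>x. f x / c \<partial>\<mu>)\<bar>"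
  proof -
    have "\<bar>(\<integral>x. f x \<partial>\<nu>) - (\<integral>x. f x \<partial>\<mu>)\<bar>
        = c * \<bar>(\<integral>x. f x / c \<partial>\<nu>) - (\<integral>x. f x / c \<partial>\<mu>)\<bar>"
      using c by (simp add: diff_divide_distrib[symmetric])
    then show ?thesis using c by (simp only: ennreal_mult less_imp_le abs_ge_zero)
  qed
  also have "\<dots> \<le> ennreal c * tv_dist \<nu> \<mu>"
  proof -
    have "\<bar>f x / c\<bar> \<le> 1" for x using c bound[of x] by simp
    then show ?thesis
      unfolding tv_dist_def by (intro mult_left_mono SUP_upper) simp_all
  qed
  finally show ?thesis .
qed

lemma nn_integral_eq_lborel_density:
  assumes "sets \<nu> = sets borel"
    and "h \<in> borel_measurable borel"
    and "\<And>B. B \<in> sets borel \<Longrightarrow> emeasure \<nu> B = (\<integral>\<^sup>+y\<in>B. h y \<partial>lborel)"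
    and "f \<in> borel_measurable borel"
  shows "(\<integral>\<^sup>+y. f y \<partial>\<nu>) = (\<integral>\<^sup>+y. h y * f y \<partial>lborel)"
proof -
  have "\<nu> = density lborel h"
  proof (rule measure_eqI)
    fix B assume "B \<in> sets \<nu>"
    then have B: "B \<in> sets borel" by (simp add: assms(1))
    have "emeasure (density lborel h) B = (\<integral>\<^sup>+y\<in>B. h y \<partial>lborel)"
      using B assms(2) by (simp add: emeasure_density)
    then show "emeasure \<nu> B = emeasure (density lborel h) B" by (simp only: assms(3)[OF B])
  qed (simp add: assms(1))
  then show ?thesis using assms(2,4) by (simp add: nn_integral_density)
qed

section \<open>The Chapman--Kolmogorov equation\<close>

context borel_right_process
begin

lemma prob_space_transition_semigroup:
  assumes "0 \<le> t"
  shows "prob_space (transition_semigroup P X t x)"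
proof -
  have "X t \<in> measurable (P x) borel"
    using measurable_X[OF assms] measurable_cong_sets[OF sets_P refl] by blast
  then show ?thesis
    unfolding transition_semigroup_def by (rule prob_space.prob_space_distr[OF prob_P])
qed

lemma natural_filtration_subalgebra:
  "subalgebra (P x) (natural_filtration M X t)"
proof -
  have "sigma_sets (space M) (\<Union>s\<in>{0..t}. {X s -` B \<inter> space M | B. B \<in> sets borel}) \<subseteq> sets M"
    using measurable_X by (intro sets.sigma_sets_subset) (auto intro: measurable_sets)
  then show ?thesis
    unfolding subalgebra_def natural_filtration_def
    using sets_eq_imp_space_eq[OF sets_P, of x]
    by (auto simp: sets_P space_measure_of_conv sets_measure_of_conv split: if_splits)
qed

text \<open>
  Taking expectations in the Markov property removes the conditional expectation, and the law of
  \<open>X t\<close> under \<open>P x\<close> is the kernel at time \<open>t\<close>.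
\<close>

lemma chapman_kolmogorov:
  assumes s: "0 \<le> s" and t: "0 \<le> t" and B: "B \<in> sets borel"
  shows "emeasure (transition_semigroup P X (t + s) x) B =
    (\<integral>\<^sup>+z. emeasure (transition_semigroup P X s z) B \<partial>transition_semigroup P X t x)"
proof -
  interpret px: prob_space "P x" by (rule prob_P)
  interpret kt: prob_space "transition_semigroup P X t x"
    by (rule prob_space_transition_semigroup[OF t])
  interpret ks: prob_space "transition_semigroup P X s z" for z
    by (rule prob_space_transition_semigroup[OF s])
  interpret kts: prob_space "transition_semigroup P X (t + s) x"
    using s t by (intro prob_space_transition_semigroup) simp
  interpret F: finite_measure_subalgebra "P x" "natural_filtration M X t"
    by unfold_locales (rule natural_filtration_subalgebra)
  have X[measurable]: "X u \<in> measurable (P x) borel" if "0 \<le> u" for u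
    using measurable_X[OF that] measurable_cong_sets[OF sets_P refl] by blast
  note [measurable] = B borel_semigroup[OF s B] X[OF t] X[of "t + s"]
  have ts: "0 \<le> t + s" using s t by simp
  have int: "integrable (P x) (\<lambda>\<omega>. indicator B (X (t + s) \<omega>) :: real)"
    using X[OF ts] by (intro px.integrable_const_bound[where B=1]) auto
  have "measure (transition_semigroup P X (t + s) x) B
      = (\<integral>\<omega>. indicator B (X (t + s) \<omega>) \<partial>P x)"
    using X[OF ts] B unfolding transition_semigroup_def
    by (simp add: integral_distr[symmetric, where f="indicator B"])
  also have "\<dots> = (\<integral>\<omega>. real_cond_exp (P x) (natural_filtration M X t)
      (\<lambda>\<omega>'. indicator B (X (t + s) \<omega>')) \<omega> \<partial>P x)"
    by (rule F.real_cond_exp_int(2)[OF int, symmetric])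
  also have "\<dots> = (\<integral>\<omega>. measure (transition_semigroup P X s (X t \<omega>)) B \<partial>P x)"
    using markov[OF s t B, of x] by (intro integral_cong_AE) auto
  also have "\<dots> = (\<integral>z. measure (transition_semigroup P X s z) B \<partial>transition_semigroup P X t x)"
    unfolding transition_semigroup_def[of P X t]
    by (rule integral_distr[symmetric]) auto
  finally have eq: "measure (transition_semigroup P X (t + s) x) B =
     (\<integral>z. measure (transition_semigroup P X s z) B \<partial>transition_semigroup P X t x)" .
  have "integrable (transition_semigroup P X t x) (\<lambda>z. measure (transition_semigroup P X s z) B)"
    by (intro kt.integrable_const_bound[where B=1]) (auto simp: transition_semigroup_def[of P X t])
  then show ?thesis
    by (simp add: kts.emeasure_eq_measure ks.emeasure_eq_measure eq nn_integral_eq_integral)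
qed

end

section \<open>Densities after a last unit of time\<close>

text \<open>
  If \<open>h\<close> is the density of the law of the process at some time, this is a version of the
  density one unit of time later. Consistency of \<open>p\<close> and \<open>\<rho>\<close> says that
  \<open>p t x\<close> is the unit step of \<open>p (t - 1) x\<close>, and that \<open>\<rho>\<close> is its own
  unit step.
\<close>

definition unit_step :: "(real \<Rightarrow> 'a::euclidean_space \<Rightarrow> 'a \<Rightarrow> real) \<Rightarrow> ('a \<Rightarrow> real) \<Rightarrow> 'a \<Rightarrow> real" where
  "unit_step p h y = enn2real (\<integral>\<^sup>+z. ennreal (h z) * ennreal (p 1 z y) \<partial>lborel)"

lemma le_sup_norm: "ennreal \<bar>f x y\<bar> \<le> sup_norm f"
  unfolding sup_norm_def by (rule SUP_upper2[of x], simp, rule SUP_upper) simp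

lemma ennreal_unit_step:
  assumes h: "h \<in> borel_measurable borel" "(\<integral>\<^sup>+z. ennreal (h z) \<partial>lborel) < \<infinity>"
    and fin: "sup_norm (p 1) < \<infinity>"
  shows "ennreal (unit_step p h y) = (\<integral>\<^sup>+z. ennreal (h z) * ennreal (p 1 z y) \<partial>lborel)"
proof -
  have "ennreal (p 1 z y) \<le> sup_norm (p 1)" for z
    using le_sup_norm[of "p 1" z y] by (rule order_trans[rotated]) (simp add: ennreal_leI)
  then have "(\<integral>\<^sup>+z. ennreal (h z) * ennreal (p 1 z y) \<partial>lborel)
      \<le> (\<integral>\<^sup>+z. ennreal (h z) * sup_norm (p 1) \<partial>lborel)"
    by (intro nn_integral_mono mult_left_mono) auto
  also have "\<dots> = (\<integral>\<^sup>+z. ennreal (h z) \<partial>lborel) * sup_norm (p 1)"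
    using h by (simp add: nn_integral_multc)
  also have "\<dots> < \<infinity>" using h fin by (simp add: ennreal_mult_less_top)
  finally show ?thesis by (simp add: unit_step_def)
qed

lemma unit_step_measurable:
  assumes [measurable]: "(\<lambda>(x, z). g x z) \<in> borel_measurable (borel \<Otimes>\<^sub>M borel)"
    and [measurable]: "(\<lambda>(z, y). p 1 z y) \<in> borel_measurable (borel \<Otimes>\<^sub>M borel)"
  shows "(\<lambda>(x, y). unit_step p (g x) y) \<in> borel_measurable (borel \<Otimes>\<^sub>M borel)"
  unfolding unit_step_def by measurable

text \<open>
  By Tonelli, the unit step of a density of \<open>\<nu>\<close> is a density of the measure obtained by
  letting \<open>\<nu>\<close> evolve for one unit of time, and densities are almost everywhere unique. The
  lemma serves both the Chapman--Kolmogorov equation, with \<open>\<nu>\<close> the law at time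
  \<open>t - 1\<close>, and the invariance equation, with \<open>\<nu> = \<mu>\<close>.
\<close>

lemma unit_step_is_density:
  assumes p: "transition_density K p" and fin: "sup_norm (p 1) < \<infinity>"
    and K: "\<And>B. B \<in> sets borel \<Longrightarrow> (\<lambda>x. emeasure (K 1 x) B) \<in> borel_measurable borel"
    and \<nu>: "prob_space \<nu>" "sets \<nu> = sets borel"
    and h: "h \<in> borel_measurable borel"
       "\<And>B. B \<in> sets borel \<Longrightarrow> emeasure \<nu> B = (\<integral>\<^sup>+y\<in>B. ennreal (h y) \<partial>lborel)"
    and k: "k \<in> borel_measurable borel" "\<And>y. 0 \<le> k y"
       "\<And>B. B \<in> sets borel \<Longrightarrow>
          (\<integral>\<^sup>+z. emeasure (K 1 z) B \<partial>\<nu>) = (\<integral>\<^sup>+y\<in>B. ennreal (k y) \<partial>lborel)"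
  shows "AE y in lborel. unit_step p h y = k y"
proof -
  note [measurable] = h(1) k(1)
  have p1[measurable]: "(\<lambda>(x, y). p 1 x y) \<in> borel_measurable (borel \<Otimes>\<^sub>M borel)"
    and pK: "\<And>x B. B \<in> sets borel \<Longrightarrow>
        emeasure (K 1 x) B = (\<integral>\<^sup>+y\<in>B. ennreal (p 1 x y) \<partial>lborel)"
    using p unfolding transition_density_def by auto
  have [measurable]: "unit_step p h \<in> borel_measurable borel"
    unfolding unit_step_def by measurable
  have "space \<nu> = UNIV" using sets_eq_imp_space_eq[OF \<nu>(2)] by simp
  then have h1: "(\<integral>\<^sup>+z. ennreal (h z) \<partial>lborel) < \<infinity>"
    using h(2)[of UNIV] prob_space.emeasure_space_1[OF \<nu>(1)] by simp
  have "density lborel (\<lambda>y. ennreal (unit_step p h y)) = density lborel (\<lambda>y. ennreal (k y))"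
  proof (rule measure_eqI)
    fix B assume "B \<in> sets (density lborel (\<lambda>y. ennreal (unit_step p h y)))"
    then have B[measurable]: "B \<in> sets borel" by simp
    have "(\<integral>\<^sup>+y\<in>B. ennreal (unit_step p h y) \<partial>lborel)
        = (\<integral>\<^sup>+y. (\<integral>\<^sup>+z. ennreal (h z) * (ennreal (p 1 z y) * indicator B y) \<partial>lborel) \<partial>lborel)"
      by (simp add: ennreal_unit_step[of h p, OF h(1) h1 fin] nn_integral_multc[symmetric] mult.assoc)
    also have "\<dots>
        = (\<integral>\<^sup>+z. (\<integral>\<^sup>+y. ennreal (h z) * (ennreal (p 1 z y) * indicator B y) \<partial>lborel) \<partial>lborel)"
      by (rule lborel_pair.Fubini') measurable
    also have "\<dots> = (\<integral>\<^sup>+z. ennreal (h z) * emeasure (K 1 z) B \<partial>lborel)"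
      by (simp add: nn_integral_cmult pK[OF B])
    also have "\<dots> = (\<integral>\<^sup>+z. emeasure (K 1 z) B \<partial>\<nu>)"
      by (rule nn_integral_eq_lborel_density[symmetric]) (use \<nu> h K in auto)
    finally show "emeasure (density lborel (\<lambda>y. ennreal (unit_step p h y))) B
        = emeasure (density lborel (\<lambda>y. ennreal (k y))) B"
      by (simp add: emeasure_density k)
  qed simp
  then have "AE y in lborel. ennreal (unit_step p h y) = ennreal (k y)"
    by (rule sigma_finite_measure.density_unique[OF sigma_finite_lborel, rotated 2]) auto
  then show ?thesis
    by eventually_elim (use k in \<open>simp add: unit_step_def ennreal_inj\<close>)
qed

text \<open>
  Both unit steps at \<open>y\<close> are integrals of the same function \<open>p 1 \<cdot> y\<close>, which is
  bounded by the supremum norm. This is why convergence in total variation, a statement about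
  measures, gives convergence of densities at each point.
\<close>

lemma unit_step_diff_le_tv_dist:
  assumes p: "transition_density K p" and fin: "sup_norm (p 1) < \<infinity>"
    and \<nu>: "prob_space \<nu>" "sets \<nu> = sets borel"
    and h: "h \<in> borel_measurable borel"
       "\<And>B. B \<in> sets borel \<Longrightarrow> emeasure \<nu> B = (\<integral>\<^sup>+y\<in>B. ennreal (h y) \<partial>lborel)"
    and \<mu>: "prob_space \<mu>" "sets \<mu> = sets borel"
    and k: "k \<in> borel_measurable borel"
       "\<And>B. B \<in> sets borel \<Longrightarrow> emeasure \<mu> B = (\<integral>\<^sup>+y\<in>B. ennreal (k y) \<partial>lborel)"
  shows "ennreal \<bar>unit_step p h y - unit_step p k y\<bar> \<le> sup_norm (p 1) * tv_dist \<nu> \<mu>"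
proof -
  have p1: "(\<lambda>(x, y). p 1 x y) \<in> borel_measurable (borel \<Otimes>\<^sub>M borel)"
    and pos: "\<And>x y. 0 \<le> p 1 x y"
    using p unfolding transition_density_def by auto
  have m[measurable]: "(\<lambda>z. p 1 z y) \<in> borel_measurable borel"
    using p1 by measurable
  define c where "c = enn2real (sup_norm (p 1))"
  have c: "ennreal c = sup_norm (p 1)" "0 \<le> c" using fin by (auto simp: c_def)
  have bound: "\<bar>p 1 z y\<bar> \<le> c" for z
    using le_sup_norm[of "p 1" z y] c by (metis ennreal_le_iff)
  have step: "unit_step p g y = (\<integral>z. p 1 z y \<partial>\<kappa>)"
    if \<kappa>: "prob_space \<kappa>" "sets \<kappa> = sets borel"
      and g: "g \<in> borel_measurable borel"
       "\<And>B. B \<in> sets borel \<Longrightarrow> emeasure \<kappa> B = (\<integral>\<^sup>+y\<in>B. ennreal (g y) \<partial>lborel)" for \<kappa> g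
  proof -
    have "(\<integral>\<^sup>+z. ennreal (g z) * ennreal (p 1 z y) \<partial>lborel) = (\<integral>\<^sup>+z. ennreal (p 1 z y) \<partial>\<kappa>)"
      by (rule nn_integral_eq_lborel_density[symmetric]) (use \<kappa> g in auto)
    moreover have "(\<integral>z. p 1 z y \<partial>\<kappa>) = enn2real (\<integral>\<^sup>+z. ennreal (p 1 z y) \<partial>\<kappa>)"
    proof (rule integral_eq_nn_integral)
      show "(\<lambda>z. p 1 z y) \<in> borel_measurable \<kappa>"
        using m by (simp add: measurable_cong_sets[OF \<kappa>(2) refl])
    qed (simp add: pos)
    ultimately show ?thesis by (simp add: unit_step_def)
  qed
  show ?thesis
    using tv_dist_bounds_integrals[OF m bound, of \<nu> \<mu>]
    by (simp only: step[of \<nu> h, OF \<nu> h] step[of \<mu> k, OF \<mu> k] c(1))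
qed

section \<open>Convergence of the densities\<close>

lemma rate_finite_and_integrable:
  assumes fin: "sup_norm (p 1) < \<infinity>"
    and lb: "locally_bounded (\<lambda>x. V x * indicator \<Lambda> x)"
    and int: "set_integrable lborel {0..} \<Xi>" and pos: "\<And>t. 0 \<le> t \<Longrightarrow> 0 \<le> \<Xi> t"
    and S: "compact S"
  shows "rate p V \<Xi> \<Lambda> C S t < \<infinity>"
    and "rate p V \<Xi> \<Lambda> C S \<in> borel_measurable (restrict_space borel {1<..})"
    and "(\<integral>\<^sup>+t\<in>{1<..}. rate p V \<Xi> \<Lambda> C S t \<partial>lborel) < \<infinity>"
proof -
  have "(SUP x\<in>S \<inter> \<Lambda>. V x) \<le> (SUP x\<in>S. V x * indicator \<Lambda> x)"
    by (rule SUP_mono) (auto intro!: bexI)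
  also have "\<dots> < \<infinity>" by (rule SUP_compact_finite[OF lb S])
  finally have V: "(SUP x\<in>S \<inter> \<Lambda>. V x) < \<infinity>" .
  define A where "A = 2 * ennreal C * sup_norm (p 1) * (SUP x\<in>S \<inter> \<Lambda>. V x)"
  have A: "A < \<infinity>" using V fin by (simp add: A_def ennreal_mult_less_top)
  have rate: "rate p V \<Xi> \<Lambda> C S t = A * ennreal (\<Xi> (t - 1))" for t
    by (simp add: rate_def A_def)
  show "rate p V \<Xi> \<Lambda> C S t < \<infinity>" using A by (simp add: rate ennreal_mult_less_top)
  \<comment> \<open>Extending \<open>\<Xi>\<close> by 0 to negative times gives a Borel function on the whole line,
    which can be translated; its integrability is given on \<open>{0..}\<close> only.\<close>
  define g where "g u = indicator {0..} u * \<Xi> u" for u :: real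
  have gi: "integrable lborel g" using int by (simp add: set_integrable_def g_def[abs_def])
  then have [measurable]: "g \<in> borel_measurable borel" by simp
  have g0: "0 \<le> g u" for u using pos by (simp add: g_def indicator_def)
  have rg: "rate p V \<Xi> \<Lambda> C S t = A * ennreal (g (t - 1))" if "t \<in> {1<..}" for t
    using that by (simp add: rate g_def)
  have "(\<lambda>t. A * ennreal (g (t - 1))) \<in> borel_measurable (restrict_space borel {1<..})"
    by (rule measurable_restrict_space1) measurable
  then show "rate p V \<Xi> \<Lambda> C S \<in> borel_measurable (restrict_space borel {1<..})"
    by (rule measurable_cong[THEN iffD1, rotated]) (simp add: rg space_restrict_space)
  have "(\<integral>\<^sup>+t\<in>{1<..}. rate p V \<Xi> \<Lambda> C S t \<partial>lborel) \<le> (\<integral>\<^sup>+t. A * ennreal (g (t - 1)) \<partial>lborel)"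
    by (intro nn_integral_mono) (auto simp: rg split: split_indicator)
  also have "\<dots> = A * (\<integral>\<^sup>+t. ennreal (g (-1 + 1 * t)) \<partial>lborel)"
    by (simp add: nn_integral_cmult)
  also have "(\<integral>\<^sup>+t. ennreal (g (-1 + 1 * t)) \<partial>lborel) = (\<integral>\<^sup>+t. ennreal (g t) \<partial>lborel)"
    using nn_integral_real_affine[of "\<lambda>t. ennreal (g t)" 1 "-1"] by simp
  also have "\<dots> = ennreal (integral\<^sup>L lborel g)"
    by (rule nn_integral_eq_integral[OF gi]) (use g0 in auto)
  finally show "(\<integral>\<^sup>+t\<in>{1<..}. rate p V \<Xi> \<Lambda> C S t \<partial>lborel) < \<infinity>"
    using A by (auto simp: ennreal_mult_less_top elim!: order.strict_trans1)
qed

lemma consistent_densities_converge: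
  assumes K: "\<And>t x. 0 \<le> t \<Longrightarrow> prob_space (K t x)" "\<And>t x. sets (K t x) = sets borel"
    and p: "transition_density K p" and \<rho>: "lebesgue_density \<mu> \<rho>" and \<mu>: "prob_space \<mu>"
    and fin: "sup_norm (p 1) < \<infinity>"
    and erg: "ergodic_at_speed K \<mu> V \<Xi> \<Lambda> C"
    and lb: "locally_bounded (\<lambda>x. V x * indicator \<Lambda> x)"
    and int: "set_integrable lborel {0..} \<Xi>"
    and cons: "consistent_densities p \<rho>"
  shows "local_uniform_density_convergence \<mu> p \<rho> \<Lambda> (rate p V \<Xi> \<Lambda> C)"
proof -
  have pos: "0 \<le> p t x y" if "0 < t" for t x y using p that by (simp add: transition_density_def)
  have p_step: "p t x y = unit_step p (p (t - 1) x) y" if "1 < t" for t x y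
    using cons pos[of t x y] that unfolding consistent_densities_def unit_step_def
    by (metis enn2real_ennreal order.strict_trans zero_less_one)
  have \<rho>_step: "\<rho> y = unit_step p \<rho> y" for y
    using cons \<rho> unfolding consistent_densities_def unit_step_def lebesgue_density_def
    by (metis enn2real_ennreal)
  have diff: "ennreal \<bar>p t x y - \<rho> y\<bar> \<le> rate p V \<Xi> \<Lambda> C S t"
    if t: "1 < t" and x: "x \<in> S \<inter> \<Lambda>" for t x y S
  proof -
    have "ennreal \<bar>p t x y - \<rho> y\<bar> = ennreal \<bar>unit_step p (p (t - 1) x) y - unit_step p \<rho> y\<bar>"
      using p_step[OF t] \<rho>_step by metis
    also have "\<dots> \<le> sup_norm (p 1) * tv_dist (K (t - 1) x) \<mu>"
    proof (rule unit_step_diff_le_tv_dist[OF p fin])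
      have pm[measurable]: "(\<lambda>(x, y). p (t - 1) x y) \<in> borel_measurable (borel \<Otimes>\<^sub>M borel)"
        using p t by (simp add: transition_density_def)
      show "p (t - 1) x \<in> borel_measurable borel" using pm by measurable
    qed (use t p K \<mu> \<rho> in \<open>auto simp: transition_density_def lebesgue_density_def emeasure_density\<close>)
    also have "\<dots> \<le> sup_norm (p 1) * (ennreal C * (SUP x\<in>S \<inter> \<Lambda>. V x) * ennreal (\<Xi> (t - 1)))"
    proof (rule mult_left_mono)
      have "tv_dist (K (t - 1) x) \<mu> \<le> ennreal C * V x * ennreal (\<Xi> (t - 1))"
        using erg t x by (simp add: ergodic_at_speed_def)
      also have "\<dots> \<le> ennreal C * (SUP x\<in>S \<inter> \<Lambda>. V x) * ennreal (\<Xi> (t - 1))"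
        by (intro mult_right_mono mult_left_mono SUP_upper x) auto
      finally show "tv_dist (K (t - 1) x) \<mu> \<le> \<dots>" .
    qed simp
    also have "\<dots> \<le> 2 * (sup_norm (p 1) * (ennreal C * (SUP x\<in>S \<inter> \<Lambda>. V x) * ennreal (\<Xi> (t - 1))))"
      by (simp add: mult_2)
    finally show ?thesis by (simp add: rate_def ac_simps)
  qed
  have "\<And>t. 0 \<le> t \<Longrightarrow> 0 \<le> \<Xi> t" and "full_set \<mu> \<Lambda>"
    using erg by (auto simp: ergodic_at_speed_def)
  then show ?thesis
    unfolding local_uniform_density_convergence_def
    using rate_finite_and_integrable[of p V \<Lambda> \<Xi>] fin lb int
    by (auto intro!: SUP_least diff)
qed

text \<open>
  For \<open>t \<le> 1\<close> the given densities are kept, so \<open>p 1\<close>, and with it the unit step, does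
  not change.
\<close>

lemma consistent_versions_exist:
  assumes K: "\<And>t x. 0 \<le> t \<Longrightarrow> prob_space (K t x)" "\<And>t x. sets (K t x) = sets borel"
    and meas: "\<And>B. B \<in> sets borel \<Longrightarrow> (\<lambda>x. emeasure (K 1 x) B) \<in> borel_measurable borel"
    and CK: "\<And>t x B. 0 \<le> t \<Longrightarrow> B \<in> sets borel \<Longrightarrow>
      emeasure (K (t + 1) x) B = (\<integral>\<^sup>+z. emeasure (K 1 z) B \<partial>K t x)"
    and p: "transition_density K p" and \<rho>: "lebesgue_density \<mu> \<rho>"
    and \<mu>: "invariant_prob K \<mu>"
    and fin: "sup_norm (p 1) < \<infinity>"
  obtains q \<sigma> where "transition_density K q" "lebesgue_density \<mu> \<sigma>" "versions p \<rho> q \<sigma>"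
    "q 1 = p 1" "consistent_densities q \<sigma>"
proof -
  define q where "q t x = (if 1 < t then unit_step p (p (t - 1) x) else p t x)" for t x
  define \<sigma> where "\<sigma> = unit_step p \<rho>"
  have pm: "(\<lambda>(x, y). p t x y) \<in> borel_measurable (borel \<Otimes>\<^sub>M borel)" if "0 < t" for t
    using p that by (simp add: transition_density_def)
  have pm': "p t x \<in> borel_measurable borel" if "0 < t" for t x
    using measurable_Pair2[OF pm[OF that], of x] by simp
  have p0: "0 \<le> p t x y" if "0 < t" for t x y
    using p that by (simp add: transition_density_def)
  have pK: "emeasure (K t x) B = (\<integral>\<^sup>+y\<in>B. ennreal (p t x y) \<partial>lborel)"
    if "0 < t" "B \<in> sets borel" for t x B
    using p that by (simp add: transition_density_def)
  have \<mu>': "prob_space \<mu>" "sets \<mu> = sets borel"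
    "\<And>B. B \<in> sets borel \<Longrightarrow> (\<integral>\<^sup>+x. emeasure (K 1 x) B \<partial>\<mu>) = emeasure \<mu> B"
    using \<mu> by (auto simp: invariant_prob_def)
  have \<rho>': "\<rho> \<in> borel_measurable borel" "\<And>y. 0 \<le> \<rho> y"
    "\<And>B. B \<in> sets borel \<Longrightarrow> emeasure \<mu> B = (\<integral>\<^sup>+y\<in>B. ennreal (\<rho> y) \<partial>lborel)"
    using \<rho> by (auto simp: lebesgue_density_def emeasure_density)
  have q1: "q 1 = p 1" by (simp add: q_def fun_eq_iff)
  have mass: "(\<integral>\<^sup>+z. ennreal (h z) \<partial>lborel) < \<infinity>"
    if "prob_space \<nu>" "sets \<nu> = sets borel"
      "\<And>B. B \<in> sets borel \<Longrightarrow> emeasure \<nu> B = (\<integral>\<^sup>+y\<in>B. ennreal (h y) \<partial>lborel)"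
    for \<nu> :: "'a measure" and h
    using that(3)[of UNIV] prob_space.emeasure_space_1[OF that(1)] sets_eq_imp_space_eq[OF that(2)]
    by simp
  have q_ae: "AE y in lborel. q t x y = p t x y" if "0 < t" for t x
  proof (cases "1 < t")
    case True
    have "AE y in lborel. unit_step p (p (t - 1) x) y = p t x y"
      by (rule unit_step_is_density[OF p fin meas, of "K (t - 1) x"])
        (use True K pm' p0 pK CK[of "t - 1" _ x, symmetric] in auto)
    then show ?thesis using True by (simp add: q_def)
  qed (simp add: q_def)
  have \<sigma>_ae: "AE y in lborel. \<sigma> y = \<rho> y"
    unfolding \<sigma>_def
    by (rule unit_step_is_density[OF p fin meas, of \<mu>]) (use \<mu>' \<rho>' in auto)
  have qm: "(\<lambda>(x, y). q t x y) \<in> borel_measurable (borel \<Otimes>\<^sub>M borel)" if "0 < t" for t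
    using that pm unit_step_measurable[of "p (t - 1)" p] by (cases "1 < t") (auto simp: q_def)
  have "transition_density K q"
    unfolding transition_density_def
  proof (intro allI impI conjI ballI)
    fix t x and B :: "'a set" assume t: "(0::real) < t" and B: "B \<in> sets borel"
    have "(\<integral>\<^sup>+y\<in>B. ennreal (q t x y) \<partial>lborel) = (\<integral>\<^sup>+y\<in>B. ennreal (p t x y) \<partial>lborel)"
      by (rule nn_integral_cong_AE) (use q_ae[OF t, of x] in auto)
    then show "emeasure (K t x) B = (\<integral>\<^sup>+y\<in>B. ennreal (q t x y) \<partial>lborel)"
      using pK[OF t B] by simp
  next
    fix t x y assume "(0::real) < t"
    then show "0 \<le> q t x y" using p0 by (simp add: q_def unit_step_def)
  qed (rule qm)
  moreover have "lebesgue_density \<mu> \<sigma>"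
  proof -
    have [measurable]: "\<sigma> \<in> borel_measurable borel"
      using measurable_Pair2[OF unit_step_measurable[of "\<lambda>_. \<rho>" p], of undefined] \<rho>'(1) pm[of 1]
      by (simp add: \<sigma>_def case_prod_beta)
    have "density lborel (\<lambda>y. ennreal (\<rho> y)) = density lborel (\<lambda>y. ennreal (\<sigma> y))"
      by (rule density_cong) (use \<sigma>_ae \<rho>'(1) in auto)
    then show ?thesis
      using \<rho> \<open>\<sigma> \<in> borel_measurable borel\<close>
      by (simp add: lebesgue_density_def \<sigma>_def unit_step_def)
  qed
  moreover have "versions p \<rho> q \<sigma>" using q_ae \<sigma>_ae by (simp add: versions_def)
  moreover have "consistent_densities q \<sigma>"
    unfolding consistent_densities_def
  proof (intro conjI allI impI)
    fix t x y assume t: "(1::real) < t"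
    have "ennreal (q t x y) = (\<integral>\<^sup>+z. ennreal (p (t - 1) x z) * ennreal (p 1 z y) \<partial>lborel)"
    proof -
      have "ennreal (unit_step p (p (t - 1) x) y)
          = (\<integral>\<^sup>+z. ennreal (p (t - 1) x z) * ennreal (p 1 z y) \<partial>lborel)"
        using t K pm' pK by (intro ennreal_unit_step mass[of "K (t - 1) x"] fin) auto
      then show ?thesis using t by (simp add: q_def)
    qed
    \<comment> \<open>If \<open>t > 2\<close>, the density at time \<open>t - 1\<close> has been replaced too, but only
      on a null set of the intermediate points \<open>z\<close>.\<close>
    also have "\<dots> = (\<integral>\<^sup>+z. ennreal (q (t - 1) x z) * ennreal (q 1 z y) \<partial>lborel)"
      by (rule nn_integral_cong_AE) (use q_ae[of "t - 1" x] t q1 in auto)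
    finally show "ennreal (q t x y) = \<dots>" .
  next
    fix y
    have "ennreal (\<sigma> y) = (\<integral>\<^sup>+z. ennreal (\<rho> z) * ennreal (p 1 z y) \<partial>lborel)"
      unfolding \<sigma>_def using \<mu>' \<rho>' by (intro ennreal_unit_step mass[of \<mu>] fin) auto
    also have "\<dots> = (\<integral>\<^sup>+z. ennreal (\<sigma> z) * ennreal (q 1 z y) \<partial>lborel)"
      by (rule nn_integral_cong_AE) (use \<sigma>_ae q1 in auto)
    finally show "ennreal (\<sigma> y) = \<dots>" .
  qed
  ultimately show ?thesis using q1 that by blast
qed

theorem lemma2p3:
  fixes M :: "'w measure"
    and P :: "'a::euclidean_space \<Rightarrow> 'w measure"
    and X :: "real \<Rightarrow> 'w \<Rightarrow> 'a"
    and p :: "real \<Rightarrow> 'a \<Rightarrow> 'a \<Rightarrow> real"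
    and \<mu> :: "'a measure" and \<rho> :: "'a \<Rightarrow> real"
    and V :: "'a \<Rightarrow> ennreal" and \<Xi> :: "real \<Rightarrow> real"
    and \<Lambda> :: "'a set" and C :: real
  assumes "borel_right_process M P X"
    and "transition_density (transition_semigroup P X) p"
    and "unique_invariant_prob (transition_semigroup P X) \<mu>"
    and "lebesgue_density \<mu> \<rho>"
    and "sup_norm (p 1) < \<infinity>"
    and "ergodic_at_speed (transition_semigroup P X) \<mu> V \<Xi> \<Lambda> C"
    and "locally_bounded (\<lambda>x. V x * indicator \<Lambda> x)"
    and "set_integrable lborel {0..} \<Xi>"
  shows "(consistent_densities p \<rho> \<longrightarrow>
            local_uniform_density_convergence \<mu> p \<rho> \<Lambda> (rate p V \<Xi> \<Lambda> C)) \<and>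
         (\<exists>q \<sigma>. transition_density (transition_semigroup P X) q \<and> lebesgue_density \<mu> \<sigma> \<and>
            versions p \<rho> q \<sigma> \<and> q 1 = p 1 \<and> consistent_densities q \<sigma> \<and>
            local_uniform_density_convergence \<mu> q \<sigma> \<Lambda> (rate p V \<Xi> \<Lambda> C))"
proof -
  let ?K = "transition_semigroup P X"
  interpret borel_right_process M P X by fact
  have K: "\<And>t x. 0 \<le> t \<Longrightarrow> prob_space (?K t x)" "\<And>t x. sets (?K t x) = sets borel"
    by (simp_all add: prob_space_transition_semigroup) (simp add: transition_semigroup_def)
  have meas: "(\<lambda>x. emeasure (?K 1 x) B) \<in> borel_measurable borel" if B: "B \<in> sets borel" for B
  proof -
    interpret k: prob_space "?K 1 x" for x by (rule K) simp
    show ?thesis unfolding k.emeasure_eq_measure using borel_semigroup[OF _ B, of 1] by simp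
  qed
  have inv: "invariant_prob ?K \<mu>" using assms(3) by (simp add: unique_invariant_prob_def)
  then have \<mu>: "prob_space \<mu>" by (simp add: invariant_prob_def)
  obtain q \<sigma> where q: "transition_density ?K q" "lebesgue_density \<mu> \<sigma>" "versions p \<rho> q \<sigma>"
    "q 1 = p 1" "consistent_densities q \<sigma>"
    by (rule consistent_versions_exist[OF K meas chapman_kolmogorov assms(2,4) inv assms(5)]) auto
  have "local_uniform_density_convergence \<mu> q \<sigma> \<Lambda> (rate q V \<Xi> \<Lambda> C)"
    by (rule consistent_densities_converge[OF K q(1,2) \<mu> _ assms(6,7,8) q(5)])
      (use assms(5) in \<open>simp_all add: q(4)\<close>)
  moreover have "rate q V \<Xi> \<Lambda> C = rate p V \<Xi> \<Lambda> C"
    by (simp add: rate_def fun_eq_iff q(4))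
  ultimately show ?thesis
    using q consistent_densities_converge[OF K assms(2,4) \<mu> assms(5,6,7,8)] by auto
qed

end
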